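(* Let $q$ be a prime power, $\kappa>0$, $n\geq1$, and let $f:\mathcal{M}\to\mathbb{C}$ be a multiplicative function with $f(1)=1$ whose power series $\mathcal{F}(z)$ converges absolutely for $|z|<1/q$, such that $|\chi(j)|\le\kappa$ for all $j\geq1$. Define $M=M(n)$ by $e^{-M}(2n)^\kappa=\max_{|z|=1/q}|\mathcal{F}^\perp(z)|$. Suppose that $\kappa+1=o(M)$ (as $n\to\infty$). Then $$|\sigma(n)|\gg\kappa(\kappa+1+M)e^{-M}(2n)^{\kappa-1}$$ if, and only if, for all $\delta\gg1$ we have $$\left|\sum_{(1-\delta)(n-1)<j\leq n}\chi(j)\sigma(n-j)\right|\gg\kappa M e^{-M}(2n)^{\kappa}.$$
   Context: $\mathbb{F}_q$ is the finite field with $q$ elements, $\mathcal{M}$ is the set of monic polynomials in $\mathbb{F}_q[t]$, $\mathcal{M}_j$ the monic polynomials of degree $j$, and $\mathcal{I}$ the monic irreducibles. For a multiplicative $f:\mathcal{M}\to\mathbb{C}$ with $f(1)=1$, set $\mathcal{F}(z)=\sum_{F\in\mathcal{M}}f(F)z^{\deg F}$, and define $\Lambda_f(F)$ by $\frac{z\mathcal{F}'(z)}{\mathcal{F}(z)}=\sum_{F\in\mathcal{M}}\Lambda_f(F)z^{\deg F}$. Define $\sigma(j)=q^{-j}\sum_{F\in\mathcal{M}_j}f(F)$ (so $\sigma(0)=1$) and $\chi(j)=q^{-j}\sum_{F\in\mathcal{M}_j}\Lambda_f(F)$; then $\mathcal{F}(z/q)=\sum_{j\ge0}\sigma(j)z^j=\exp\big(\sum_{j\ge1}\frac{\chi(j)}{j}z^j\big)$.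 Given $n$, $\mathcal{F}^\perp(z)=\exp\big(\sum_{j=1}^{n-1}\frac{\chi(j)}{j}(qz)^j\big)$ (the power series of the multiplicative function whose von Mangoldt function agrees with $\Lambda_f$ on polynomials of degree $<n$ and vanishes otherwise). Asymptotic notation $\gg$, $o(\cdot)$ refers to $n\to\infty$; "$\delta\gg1$" means $\delta$ (with $0<\delta<1$) bounded below by a positive constant. *)

theory Defs
  imports
    "HOL-Analysis.Analysis"
    "HOL-Algebra.Polynomial_Divisibility"
    "HOL-Computational_Algebra.Formal_Power_Series"
    "HOL-Library.Landau_Symbols"
begin

text \<open>
  The coefficient field is a HOL-Algebra structure \<open>R\<close> with a finite carrier, rather than a type,
  so that \<open>q\<close>, which is \<open>order R\<close>, can vary within a family.  Polynomials are coefficient lists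
  with the leading coefficient first; functions on monic polynomials are functions on such lists
  whose values elsewhere are irrelevant.
\<close>

definition monics :: "('a, 'b) ring_scheme \<Rightarrow> 'a list set" where
  "monics R = {F \<in> carrier (poly_ring R). F \<noteq> [] \<and> Polynomials.lead_coeff F = \<one>\<^bsub>R\<^esub>}"

definition monics_deg :: "('a, 'b) ring_scheme \<Rightarrow> nat \<Rightarrow> 'a list set" where
  "monics_deg R j = {F \<in> monics R. Polynomials.degree F = j}"

definition poly_coprime :: "('a, 'b) ring_scheme \<Rightarrow> 'a list \<Rightarrow> 'a list \<Rightarrow> bool" where
  "poly_coprime R F G \<longleftrightarrow>
     (\<forall>D \<in> carrier (poly_ring R).
        D pdivides\<^bsub>R\<^esub> F \<longrightarrow> D pdivides\<^bsub>R\<^esub> G \<longrightarrow> D \<in> Units (poly_ring R))"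

definition multiplicative_on_monics ::
    "('a, 'b) ring_scheme \<Rightarrow> ('a list \<Rightarrow> complex) \<Rightarrow> bool" where
  "multiplicative_on_monics R f \<longleftrightarrow>
     (\<forall>F \<in> monics R. \<forall>G \<in> monics R.
        poly_coprime R F G \<longrightarrow> f (F \<otimes>\<^bsub>poly_ring R\<^esub> G) = f F * f G)"

text \<open>The series \<open>\<Sum>F. g F * z ^ deg F\<close> over monic \<open>F\<close>, as a formal power series in \<open>z\<close>.\<close>

definition gen_series ::
    "('a, 'b) ring_scheme \<Rightarrow> ('a list \<Rightarrow> complex) \<Rightarrow> complex fps" where
  "gen_series R g = Abs_fps (\<lambda>j. \<Sum>F \<in> monics_deg R j. g F)"

definition converges_absolutely ::
    "('a, 'b) ring_scheme \<Rightarrow> ('a list \<Rightarrow> complex) \<Rightarrow> bool" where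
  "converges_absolutely R f \<longleftrightarrow>
     (\<forall>z::complex. norm z < 1 / real (order R) \<longrightarrow>
        (\<lambda>F. norm (f F * z ^ Polynomials.degree F)) summable_on monics R)"

text \<open>
  The defining equation \<open>z F'(z) / F(z) = \<Sum>F. \<Lambda>\<^sub>f F * z ^ deg F\<close>.  It pins down only the sums of
  \<open>\<Lambda>\<^sub>f\<close> over all monic polynomials of a given degree, and \<open>\<Lambda>\<^sub>f\<close> enters everything below only
  through those sums.
\<close>

definition is_von_mangoldt ::
    "('a, 'b) ring_scheme \<Rightarrow> ('a list \<Rightarrow> complex) \<Rightarrow> ('a list \<Rightarrow> complex) \<Rightarrow> bool" where
  "is_von_mangoldt R f \<Lambda> \<longleftrightarrow>
     fps_X * fps_deriv (gen_series R f) / gen_series R f = gen_series R \<Lambda>"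

definition sigma_mean ::
    "('a, 'b) ring_scheme \<Rightarrow> ('a list \<Rightarrow> complex) \<Rightarrow> nat \<Rightarrow> complex" where
  "sigma_mean R f j = (\<Sum>F \<in> monics_deg R j. f F) / of_nat (order R) ^ j"

definition chi_mean ::
    "('a, 'b) ring_scheme \<Rightarrow> ('a list \<Rightarrow> complex) \<Rightarrow> nat \<Rightarrow> complex" where
  "chi_mean R \<Lambda> j = (\<Sum>F \<in> monics_deg R j. \<Lambda> F) / of_nat (order R) ^ j"

definition F_perp ::
    "('a, 'b) ring_scheme \<Rightarrow> ('a list \<Rightarrow> complex) \<Rightarrow> nat \<Rightarrow> complex \<Rightarrow> complex" where
  "F_perp R \<Lambda> n z =
     exp (\<Sum>j = 1..<n. chi_mean R \<Lambda> j / of_nat j * (of_nat (order R) * z) ^ j)"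

text \<open>The maximum over the circle; it is attained, since \<open>F_perp R \<Lambda> n\<close> is continuous.\<close>

definition max_F_perp :: "('a, 'b) ring_scheme \<Rightarrow> ('a list \<Rightarrow> complex) \<Rightarrow> nat \<Rightarrow> real" where
  "max_F_perp R \<Lambda> n = (SUP z \<in> sphere 0 (1 / real (order R)). norm (F_perp R \<Lambda> n z))"

text \<open>\<open>\<delta> \<ggreater> 1\<close> with \<open>0 < \<delta> < 1\<close>.\<close>

definition admissible_delta :: "(nat \<Rightarrow> real) \<Rightarrow> bool" where
  "admissible_delta \<delta> \<longleftrightarrow> (\<forall>k. 0 < \<delta> k \<and> \<delta> k < 1) \<and> (\<exists>c>0. \<forall>k. c \<le> \<delta> k)"

end

theory Submission
  imports Defs "HOL-Complex_Analysis.Complex_Analysis"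
begin

text \<open>
  The logarithmic derivative gives \<open>n \<sigma>(n) = (\<Sum>1 \<le> j \<le> n. chi(j) \<sigma>(n - j))\<close>, so the two quantities
  differ by the sum over \<open>j \<le> (1 - \<delta>) (n - 1)\<close>.  On the unit circle \<open>z F\<^sup>\<bottom>'\<close> is \<open>F\<^sup>\<bottom>\<close> times the
  polynomial \<open>\<Sum>j<n. chi(j) z ^ j\<close>, and the sum in question is the coefficient of \<open>z ^ n\<close> in
  \<open>A(z) * z F\<^sup>\<bottom>'(z)\<close> for a polynomial \<open>A\<close> with coefficients \<open>chi(j) / (n - j)\<close>.  By Cauchy-Schwarz
  and Parseval it is at most \<open>\<kappa>\<^sup>2 / \<delta>\<close> times the maximum of \<open>F\<^sup>\<bottom>\<close>, which is negligible because
  \<open>\<kappa> + 1 = o(M)\<close>.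
\<close>

section \<open>Discrete Fourier analysis at the N-th roots of unity, replacing integrals over the
  unit circle\<close>

definition unity_root :: "nat \<Rightarrow> nat \<Rightarrow> complex" where
  "unity_root N r = cis (2 * pi * real r / real N)"

lemma norm_unity_root [simp]: "norm (unity_root N r) = 1"
  by (simp add: unity_root_def)

lemma unity_root_power_commute: "unity_root N r ^ j = unity_root N j ^ r"
  by (simp add: unity_root_def Complex.DeMoivre mult_ac)

text \<open>The sum is geometric in r with ratio an N-th root of unity \<open>u\<close>. Distinct
  exponents below N give distinct roots, so \<open>u\<close> is 1 only on the diagonal.\<close>

lemma unity_root_orthogonal:
  assumes "j < N" "k < N"
  shows "(\<Sum>r<N. unity_root N r ^ j * cnj (unity_root N r ^ k)) = (if j = k then of_nat N else 0)"
proof -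
  define u where "u = unity_root N j * cnj (unity_root N k)"
  have bij: "bij_betw (unity_root N) {..<N} {z. z ^ N = 1}"
    using Complex.bij_betw_roots_unity[of N] assms unfolding unity_root_def by auto
  have "unity_root N j ^ N = 1" "unity_root N k ^ N = 1"
    using bij assms by (auto simp: bij_betw_def)
  then have "u ^ N = 1"
    by (simp add: u_def power_mult_distrib flip: complex_cnj_power)
  moreover have "u = 1 \<longleftrightarrow> j = k"
  proof
    assume "u = 1"
    then have "unity_root N j * (cnj (unity_root N k) * unity_root N k) = unity_root N k"
      by (simp add: u_def)
    moreover have "cnj (unity_root N k) * unity_root N k = 1"
      by (simp add: complex_norm_square[symmetric] mult.commute)
    ultimately have "unity_root N j = unity_root N k"
      by simp
    then show "j = k"
      using bij assms by (auto simp: bij_betw_def inj_on_def)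
  qed (simp add: u_def complex_norm_square[symmetric])
  moreover have "(\<Sum>r<N. unity_root N r ^ j * cnj (unity_root N r ^ k)) = (\<Sum>r<N. u ^ r)"
    by (intro sum.cong refl)
      (simp only: u_def power_mult_distrib complex_cnj_power unity_root_power_commute[of N _ j]
        unity_root_power_commute[of N _ k])
  ultimately show ?thesis
    by (simp add: sum_gp_strict)
qed

text \<open>Expand the square and sum over the sample points first; orthogonality leaves the
  diagonal. Exponents below N cannot alias, so the discrete mean square is exact.\<close>

lemma unity_root_parseval:
  assumes "J \<subseteq> {..<N}"
  shows "(\<Sum>r<N. (norm (\<Sum>j\<in>J. a j * unity_root N r ^ j))\<^sup>2) = real N * (\<Sum>j\<in>J. (norm (a j))\<^sup>2)"
proof -
  have [simp]: "finite J"
    using assms finite_subset by blast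
  let ?w = "unity_root N"
  have "of_real (\<Sum>r<N. (norm (\<Sum>j\<in>J. a j * ?w r ^ j))\<^sup>2)
      = (\<Sum>r<N. (\<Sum>j\<in>J. a j * ?w r ^ j) * cnj (\<Sum>k\<in>J. a k * ?w r ^ k))"
    by (simp only: complex_norm_square of_real_sum)
  also have "\<dots> = (\<Sum>r<N. \<Sum>j\<in>J. \<Sum>k\<in>J. a j * cnj (a k) * (?w r ^ j * cnj (?w r ^ k)))"
    by (simp add: sum_product mult_ac)
  also have "\<dots> = (\<Sum>j\<in>J. \<Sum>k\<in>J. a j * cnj (a k) * (\<Sum>r<N. ?w r ^ j * cnj (?w r ^ k)))"
    by (simp only: sum_distrib_left sum.swap[of _ "J" "{..<N}"])
  also have "\<dots> = (\<Sum>j\<in>J. \<Sum>k\<in>J. if j = k then of_nat N * (a j * cnj (a k)) else 0)"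
    using assms by (intro sum.cong refl) (subst unity_root_orthogonal, auto)
  also have "\<dots> = of_real (real N * (\<Sum>j\<in>J. (norm (a j))\<^sup>2))"
    by (simp add: sum_distrib_left complex_norm_square[symmetric] del: of_real_power)
  finally show ?thesis
    by (simp only: of_real_eq_iff)
qed

text \<open>A discrete Cauchy formula. Sampling at N points cannot separate exponents congruent
  modulo N, so the tail from N on is subtracted first. Orthogonality is exact for the remaining
  polynomial, and the tail costs at most its absolute sum at each sample point.\<close>

lemma coefficient_unity_root_approx:
  assumes "summable (\<lambda>k. norm (g k))" and "n < N"
  shows "real N * norm (g n) \<le>
    (\<Sum>r<N. norm (\<Sum>k. g k * unity_root N r ^ k)) + real N * (\<Sum>k. norm (g (k + N)))"
proof -
  let ?w = "unity_root N"
  define T where "T r = (\<Sum>k. g (k + N) * ?w r ^ (k + N))" for r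
  have sum: "summable (\<lambda>k. norm (g k * ?w r ^ k))" for r
    using assms by (simp add: norm_mult norm_power)
  have split: "(\<Sum>k. g k * ?w r ^ k) = T r + (\<Sum>k<N. g k * ?w r ^ k)" for r
    unfolding T_def by (rule suminf_split_initial_segment[OF summable_norm_cancel[OF sum]])
  have T: "norm (T r) \<le> (\<Sum>k. norm (g (k + N)))" for r
    unfolding T_def
    using summable_norm[of "\<lambda>k. g (k + N) * ?w r ^ (k + N)"]
      summable_ignore_initial_segment[OF assms(1), of N]
    by (simp add: norm_mult norm_power)
  have "of_nat N * g n = (\<Sum>k<N. g k * (if k = n then of_nat N else 0))"
    using assms by (simp add: if_distrib[of "\<lambda>x. _ * x"] mult.commute cong: if_cong)
  also have "\<dots> = (\<Sum>k<N. g k * (\<Sum>r<N. ?w r ^ k * cnj (?w r ^ n)))"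
    using assms by (intro sum.cong refl) (subst unity_root_orthogonal, auto)
  also have "\<dots> = (\<Sum>r<N. \<Sum>k<N. g k * (?w r ^ k * cnj (?w r ^ n)))"
    by (simp only: sum_distrib_left) (rule sum.swap)
  also have "\<dots> = (\<Sum>r<N. ((\<Sum>k. g k * ?w r ^ k) - T r) * cnj (?w r ^ n))"
    by (simp only: split) (simp add: sum_distrib_left mult_ac)
  finally have "real N * norm (g n) = norm \<dots>"
    by (metis norm_mult norm_of_nat)
  also have "\<dots> \<le> (\<Sum>r<N. norm (\<Sum>k. g k * ?w r ^ k) + (\<Sum>k. norm (g (k + N))))"
  proof (rule sum_norm_le)
    fix r
    show "norm (((\<Sum>k. g k * ?w r ^ k) - T r) * cnj (?w r ^ n))
      \<le> norm (\<Sum>k. g k * ?w r ^ k) + (\<Sum>k. norm (g (k + N)))"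
      using norm_triangle_ineq4[of "\<Sum>k. g k * ?w r ^ k" "T r"] T[of r]
      by (simp add: norm_mult norm_power)
  qed
  also have "\<dots> = (\<Sum>r<N. norm (\<Sum>k. g k * ?w r ^ k)) + real N * (\<Sum>k. norm (g (k + N)))"
    by (simp add: sum.distrib)
  finally show ?thesis .
qed

text \<open>Cauchy-Schwarz is applied to the sampled values of the two polynomial factors, and
  Parseval evaluates both mean squares. The factors N cancel, and the aliasing error vanishes as N
  grows, whence the arbitrary \<open>e\<close>.\<close>

lemma coefficient_bound_product:
  fixes a b g :: "nat \<Rightarrow> complex"
  assumes "summable (\<lambda>k. norm (g k))" and "finite I" and "finite J" and "0 \<le> K"
    and le: "\<And>z. norm z = 1 \<Longrightarrow>
      norm (\<Sum>k. g k * z ^ k) \<le> K * (norm (\<Sum>i\<in>I. a i * z ^ i) * norm (\<Sum>j\<in>J. b j * z ^ j))"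
  shows "norm (g n) \<le> K * sqrt ((\<Sum>i\<in>I. (norm (a i))\<^sup>2) * (\<Sum>j\<in>J. (norm (b j))\<^sup>2))"
proof (rule field_le_epsilon)
  fix e :: real
  assume "0 < e"
  then obtain N0 where N0: "\<And>N. N \<ge> N0 \<Longrightarrow> norm (\<Sum>k. norm (g (k + N))) < e"
    using suminf_exist_split[OF _ assms(1)] by blast
  obtain m where m: "I \<union> J \<subseteq> {..<m}"
    using finite_nat_iff_bounded[of "I \<union> J"] assms by auto
  \<comment> \<open>N exceeds every exponent in \<open>I\<close> and \<open>J\<close> for Parseval,
    exceeds n for the extraction, and is large enough to push the tail below
    \<open>e\<close>.\<close>
  define N where "N = max (max N0 m) (Suc n)"
  have N: "N \<ge> N0" "I \<subseteq> {..<N}" "J \<subseteq> {..<N}" "n < N" "0 < N"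
    using m by (auto simp: N_def)
  let ?w = "unity_root N"
  let ?A = "\<lambda>r. norm (\<Sum>i\<in>I. a i * ?w r ^ i)" and ?B = "\<lambda>r. norm (\<Sum>j\<in>J. b j * ?w r ^ j)"
  let ?R = "sqrt ((\<Sum>i\<in>I. (norm (a i))\<^sup>2) * (\<Sum>j\<in>J. (norm (b j))\<^sup>2))"
  have "(\<Sum>r<N. ?A r * ?B r) \<le> sqrt ((\<Sum>r<N. (?A r)\<^sup>2) * (\<Sum>r<N. (?B r)\<^sup>2))"
    by (intro real_le_rsqrt Cauchy_Schwarz_ineq_sum)
  also have "\<dots> = real N * ?R"
    unfolding unity_root_parseval[OF N(2)] unity_root_parseval[OF N(3)]
    by (simp add: real_sqrt_mult)
  finally have *: "(\<Sum>r<N. ?A r * ?B r) \<le> real N * ?R" .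
  have "real N * norm (g n) \<le>
      (\<Sum>r<N. norm (\<Sum>k. g k * ?w r ^ k)) + real N * (\<Sum>k. norm (g (k + N)))"
    using coefficient_unity_root_approx assms(1) N(4) .
  also have "(\<Sum>r<N. norm (\<Sum>k. g k * ?w r ^ k)) \<le> (\<Sum>r<N. K * (?A r * ?B r))"
    by (intro sum_mono le) simp
  also have "\<dots> \<le> K * (real N * ?R)"
    unfolding sum_distrib_left[symmetric] using * \<open>0 \<le> K\<close> by (rule mult_left_mono)
  also have "real N * (\<Sum>k. norm (g (k + N))) \<le> real N * e"
    using N0[OF N(1)] by (intro mult_left_mono) auto
  finally have "real N * norm (g n) \<le> real N * (K * ?R + e)"
    by (simp add: algebra_simps)
  then show "norm (g n) \<le> K * ?R + e"
    using \<open>0 < N\<close> by simp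
qed

section \<open>Taylor coefficients of the truncated exponential\<close>

text \<open>Since z P' = L P with the polynomial \<open>L n\<close>, the Taylor coefficients obey
  the recursion for \<open>\<sigma>\<close> with the terms i \<ge> n removed. Such terms do not
  occur below degree n, so induction gives agreement there.\<close>

lemma exp_polynomial_expansion:
  fixes chi \<sigma> :: "nat \<Rightarrow> complex"
  defines "P \<equiv> \<lambda>n z. exp (\<Sum>j=1..<n. chi j / of_nat j * z ^ j)"
    and "L \<equiv> \<lambda>n. \<Sum>j=1..<n. fps_const (chi j) * fps_X ^ j"
  assumes "\<sigma> 0 = 1"
    and rec: "\<And>j. 1 \<le> j \<Longrightarrow> of_nat j * \<sigma> j = (\<Sum>i=1..j. chi i * \<sigma> (j - i))"
  obtains e where "P n has_fps_expansion e" and "fps_X * fps_deriv e = L n * e"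
    and "\<And>k. k < n \<Longrightarrow> fps_nth e k = \<sigma> k"
proof -
  define e where "e = fps_expansion (P n) 0"
  have hol: "P n holomorphic_on UNIV"
    unfolding P_def by (intro holomorphic_intros)
  have e: "P n has_fps_expansion e"
    unfolding e_def using hol by (intro has_fps_expansion_fps_expansion[of UNIV]) auto
  have deriv: "z * deriv (P n) z = (\<Sum>j=1..<n. chi j * z ^ j) * P n z" for z
  proof -
    have "(P n has_field_derivative P n z * (\<Sum>j=1..<n. chi j * z ^ (j - 1))) (at z)"
      unfolding P_def by (auto intro!: derivative_eq_intros sum.cong simp: field_simps)
    then have "z * deriv (P n) z = (\<Sum>j=1..<n. chi j * (z * z ^ (j - 1))) * P n z"
      by (simp add: DERIV_imp_deriv sum_distrib_left sum_distrib_right mult_ac)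
    also have "(\<Sum>j=1..<n. chi j * (z * z ^ (j - 1))) = (\<Sum>j=1..<n. chi j * z ^ j)"
      by (intro sum.cong refl) (simp flip: power_Suc)
    finally show ?thesis .
  qed
  have "(\<lambda>z. z * deriv (P n) z) has_fps_expansion fps_X * fps_deriv e"
    by (intro fps_expansion_intros e)
  moreover have "(\<lambda>z. (\<Sum>j=1..<n. chi j * z ^ j) * P n z) has_fps_expansion L n * e"
    unfolding L_def by (intro fps_expansion_intros e)
  ultimately have ode: "fps_X * fps_deriv e = L n * e"
    unfolding deriv by (rule fps_expansion_unique_complex)
  have coeff: "of_nat k * fps_nth e k = (\<Sum>i=1..k. chi i * fps_nth e (k - i))" if "k < n" for k
  proof -
    have "of_nat k * fps_nth e k = fps_nth (L n * e) k"
      unfolding ode[symmetric] by (cases k) auto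
    also have "\<dots> = (\<Sum>i=1..<n. chi i * (if k < i then 0 else fps_nth e (k - i)))"
      by (simp add: L_def sum_distrib_right fps_sum_nth mult.assoc fps_X_power_mult_nth)
    \<comment> \<open>As k < n, the cut at n loses nothing: the indices strictly between k and n
      contribute 0.\<close>
    also have "\<dots> = (\<Sum>i=1..k. chi i * fps_nth e (k - i))"
      using that by (intro sum.mono_neutral_cong_right) auto
    finally show ?thesis .
  qed
  have "fps_nth e k = \<sigma> k" if "k < n" for k
    using that
  proof (induction k rule: less_induct)
    case (less k)
    show ?case
    proof (cases "k = 0")
      case True
      \<comment> \<open>Every exponent is positive, so the polynomial vanishes at 0 and
        \<open>P n 0\<close> is 1, the value of \<open>\<sigma> 0\<close>.\<close>
      have "(\<Sum>j = Suc 0..<n. chi j * 0 ^ j / of_nat j) = 0"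
        by (intro sum.neutral) auto
      then show ?thesis
        using has_fps_expansion_imp_0_eq_fps_nth_0[OF e] True assms(3) by (simp add: P_def)
    next
      case False
      have "of_nat k * fps_nth e k = (\<Sum>i=1..k. chi i * \<sigma> (k - i))"
        unfolding coeff[OF less.prems] using less by (intro sum.cong refl) auto
      also have "\<dots> = of_nat k * \<sigma> k"
        using rec[of k] False by simp
      finally show ?thesis
        using False by simp
    qed
  qed
  with e ode that show ?thesis by blast
qed

section \<open>Mean-square bound for the terms far from n\<close>

text \<open>As j \<ge> 1, only \<open>\<sigma>\<close> at indices below n occurs, where it equals
  the coefficient of the truncated exponential. The distance of j from n bounds each weight by
  \<kappa>/(\<delta> n), so the two coefficient sums are at most \<kappa>^2/(\<delta>^2 n) and n
  \<kappa>^2, and the powers of n cancel.\<close>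

lemma convolution_bound:
  fixes chi \<sigma> :: "nat \<Rightarrow> complex" and \<kappa> K \<delta> :: real
  assumes "\<sigma> 0 = 1"
    and rec: "\<And>j. 1 \<le> j \<Longrightarrow> of_nat j * \<sigma> j = (\<Sum>i=1..j. chi i * \<sigma> (j - i))"
    and chi: "\<And>j. 1 \<le> j \<Longrightarrow> norm (chi j) \<le> \<kappa>"
    and K: "\<And>z. norm z = 1 \<Longrightarrow> norm (exp (\<Sum>j=1..<n. chi j / of_nat j * z ^ j)) \<le> K"
    and J: "J \<subseteq> {1..<n}" and far: "\<And>j. j \<in> J \<Longrightarrow> \<delta> * real n \<le> real n - real j"
    and "0 < \<delta>" and "1 \<le> n"
  shows "norm (\<Sum>j\<in>J. chi j * \<sigma> (n - j)) \<le> \<kappa>\<^sup>2 * K / \<delta>"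
proof -
  define P where "P z = exp (\<Sum>j=1..<n. chi j / of_nat j * z ^ j)" for z
  define L where "L = (\<Sum>j=1..<n. fps_const (chi j) * fps_X ^ j)"
  obtain e where e: "P has_fps_expansion e" and ode: "fps_X * fps_deriv e = L * e"
    and \<sigma>: "\<And>k. k < n \<Longrightarrow> fps_nth e k = \<sigma> k"
    using exp_polynomial_expansion[of \<sigma> chi n] assms(1,2) unfolding P_def L_def by blast
  \<comment> \<open>The coefficient of z^k in z P' is k \<open>\<sigma> k\<close> for k < n; the
    divisor cancels this factor at k = n - j, which is positive on \<open>J\<close>.\<close>
  define a where "a j = chi j / of_nat (n - j)" for j
  define A where "A = (\<Sum>j\<in>J. fps_const (a j) * fps_X ^ j)"
  define G where "G z = (\<Sum>j\<in>J. a j * z ^ j) * ((\<Sum>j=1..<n. chi j * z ^ j) * P z)" for z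
  have "finite J"
    using J finite_subset by blast
  have G: "G has_fps_expansion A * (L * e)"
    unfolding G_def A_def L_def by (intro fps_expansion_intros e)
  have hol: "G holomorphic_on S" for S
    unfolding G_def P_def by (intro holomorphic_intros)
  \<comment> \<open>\<open>G\<close> is entire, so its series converges absolutely at radius 1, as
    the sampling argument requires.\<close>
  have "fps_conv_radius (A * (L * e)) \<ge> \<infinity>"
    using holomorphic_on_imp_fps_conv_radius_ge[OF G hol] .
  then have summable: "summable (\<lambda>k. norm (fps_nth (A * (L * e)) k))"
    using norm_summable_fps[of 1 "A * (L * e)"] by simp
  have eval: "(\<Sum>k. fps_nth (A * (L * e)) k * z ^ k) = G z" for z
    using has_fps_expansion_imp_sums_complex[OF G hol, of z \<infinity>] by (simp add: sums_iff)
  have "0 \<le> K"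
    using K[of 1] norm_ge_zero order_trans by (metis norm_one)
  have "norm (fps_nth (A * (L * e)) n)
      \<le> K * sqrt ((\<Sum>j\<in>J. (norm (a j))\<^sup>2) * (\<Sum>j=1..<n. (norm (chi j))\<^sup>2))"
  proof (rule coefficient_bound_product[OF summable])
    fix z :: complex
    assume "norm z = 1"
    then have "norm (P z) \<le> K"
      using K by (simp add: P_def)
    then have "norm (\<Sum>j\<in>J. a j * z ^ j) * norm (\<Sum>j=1..<n. chi j * z ^ j) * norm (P z)
      \<le> norm (\<Sum>j\<in>J. a j * z ^ j) * norm (\<Sum>j=1..<n. chi j * z ^ j) * K"
      by (intro mult_left_mono) auto
    then show "norm (\<Sum>k. fps_nth (A * (L * e)) k * z ^ k)
      \<le> K * (norm (\<Sum>j\<in>J. a j * z ^ j) * norm (\<Sum>j=1..<n. chi j * z ^ j))"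
      unfolding eval G_def norm_mult by (simp only: mult_ac)
  qed (use \<open>finite J\<close> \<open>0 \<le> K\<close> in auto)
  also have "fps_nth (A * (L * e)) n = (\<Sum>j\<in>J. chi j * \<sigma> (n - j))"
  proof -
    have nth: "fps_nth (L * e) k = of_nat k * fps_nth e k" for k
      unfolding ode[symmetric] by (cases k) auto
    have "fps_nth (A * (L * e)) n
        = (\<Sum>j\<in>J. a j * (if n < j then 0 else fps_nth (L * e) (n - j)))"
      by (simp add: A_def sum_distrib_right fps_sum_nth mult.assoc fps_X_power_mult_nth)
    also have "\<dots> = (\<Sum>j\<in>J. chi j * \<sigma> (n - j))"
      using J by (intro sum.cong refl) (auto simp: nth a_def \<sigma> subset_iff)
    finally show ?thesis .
  qed
  also have "K * sqrt ((\<Sum>j\<in>J. (norm (a j))\<^sup>2) * (\<Sum>j=1..<n. (norm (chi j))\<^sup>2)) \<le> K * (\<kappa>\<^sup>2 / \<delta>)"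
  proof (intro mult_left_mono \<open>0 \<le> K\<close> real_le_lsqrt)
    have "(\<Sum>j\<in>J. (norm (a j))\<^sup>2) \<le> (\<Sum>j\<in>J. (\<kappa> / (\<delta> * real n))\<^sup>2)"
    proof (intro sum_mono power_mono)
      fix j
      assume "j \<in> J"
      then have "1 \<le> j" "j < n" "\<delta> * real n \<le> real (n - j)"
        using J far[of j] by (auto simp: of_nat_diff subset_iff)
      then show "norm (a j) \<le> \<kappa> / (\<delta> * real n)"
        unfolding a_def norm_divide norm_of_nat
        using chi[of j] \<open>0 < \<delta>\<close> by (intro frac_le) (auto intro: order_trans[OF norm_ge_zero])
    qed auto
    also have "\<dots> = real (card J) * (\<kappa> / (\<delta> * real n))\<^sup>2"
      by simp
    also have "\<dots> \<le> real n * (\<kappa> / (\<delta> * real n))\<^sup>2"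
      using card_mono[OF _ J] by (intro mult_right_mono) auto
    finally have 1: "(\<Sum>j\<in>J. (norm (a j))\<^sup>2) \<le> real n * (\<kappa> / (\<delta> * real n))\<^sup>2" .
    have "(\<Sum>j=1..<n. (norm (chi j))\<^sup>2) \<le> (\<Sum>j=1..<n. \<kappa>\<^sup>2)"
      using chi by (intro sum_mono power_mono) auto
    also have "\<dots> \<le> real n * \<kappa>\<^sup>2"
      by (simp add: mult_right_mono)
    finally have 2: "(\<Sum>j=1..<n. (norm (chi j))\<^sup>2) \<le> real n * \<kappa>\<^sup>2" .
    have "(\<Sum>j\<in>J. (norm (a j))\<^sup>2) * (\<Sum>j=1..<n. (norm (chi j))\<^sup>2)
        \<le> (real n * (\<kappa> / (\<delta> * real n))\<^sup>2) * (real n * \<kappa>\<^sup>2)"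
      by (intro mult_mono 1 2 sum_nonneg) auto
    also have "\<dots> = (\<kappa>\<^sup>2 / \<delta>)\<^sup>2"
      using \<open>1 \<le> n\<close> by (simp add: field_simps power2_eq_square)
    finally show "(\<Sum>j\<in>J. (norm (a j))\<^sup>2) * (\<Sum>j=1..<n. (norm (chi j))\<^sup>2) \<le> (\<kappa>\<^sup>2 / \<delta>)\<^sup>2" .
  qed (use \<open>0 < \<delta>\<close> in auto)
  finally show ?thesis
    by (simp add: mult_ac)
qed

section \<open>Mean values over monic polynomials\<close>

lemma monics_deg_zero:
  assumes "field R"
  shows "monics_deg R 0 = {\<one>\<^bsub>poly_ring R\<^esub>}"
proof -
  interpret field R by fact
  have "F = [\<one>\<^bsub>R\<^esub>]" if "F \<noteq> []" "length F - 1 = 0" "hd F = \<one>\<^bsub>R\<^esub>" for F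
    using that by (cases F) auto
  moreover have "[\<one>\<^bsub>R\<^esub>] \<in> carrier (poly_ring R)"
    by (auto simp: univ_poly_carrier[symmetric] polynomial_def)
  ultimately show ?thesis
    by (auto simp: monics_deg_def monics_def univ_poly_one)
qed

lemma sigma_mean_zero:
  assumes "field R" and "f \<one>\<^bsub>poly_ring R\<^esub> = 1"
  shows "sigma_mean R f 0 = 1"
  using assms by (simp add: sigma_mean_def monics_deg_zero)

text \<open>Clear the denominator in the equation defining \<Lambda>, compare coefficients of z^j,
  and distribute q^j as q^i q^(j-i).\<close>

lemma sigma_mean_recursion:
  assumes "field R" and "finite (carrier R)" and "f \<one>\<^bsub>poly_ring R\<^esub> = 1"
    and "is_von_mangoldt R f \<Lambda>"
  shows "of_nat j * sigma_mean R f j = (\<Sum>i=1..j. chi_mean R \<Lambda> i * sigma_mean R f (j - i))"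
proof -
  interpret field R by fact
  have q: "order R \<noteq> 0"
    using assms(2) order_gt_0_iff_finite by simp
  let ?f = "gen_series R f" and ?L = "gen_series R \<Lambda>"
  \<comment> \<open>Constant term 1 makes the series a unit, so the formal quotient is a product
    with its inverse.\<close>
  have 1: "fps_nth ?f 0 = 1"
    using assms by (simp add: gen_series_def monics_deg_zero)
  have "fps_X * fps_deriv ?f = (fps_X * fps_deriv ?f) * (inverse ?f * ?f)"
    using inverse_mult_eq_1[of ?f] 1 by simp
  also have "\<dots> = ?L * ?f"
    using assms(4) 1 by (simp add: is_von_mangoldt_def fps_divide_unit mult.assoc[symmetric])
  finally have eq: "fps_X * fps_deriv ?f = ?L * ?f" .
  \<comment> \<open>The factor z on the left kills the degree-0 sum of \<Lambda>, so the convolution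
    starts at i = 1.\<close>
  have L0: "fps_nth ?L 0 = 0"
    using arg_cong[OF eq, of "\<lambda>h. fps_nth h 0"] 1 by simp
  have \<sigma>: "sigma_mean R f i = fps_nth ?f i / of_nat (order R) ^ i" for i
    by (simp add: sigma_mean_def gen_series_def)
  have chi: "chi_mean R \<Lambda> i = fps_nth ?L i / of_nat (order R) ^ i" for i
    by (simp add: chi_mean_def gen_series_def)
  have "of_nat j * fps_nth ?f j = fps_nth (?L * ?f) j"
    unfolding eq[symmetric] by (cases j) auto
  also have "\<dots> = (\<Sum>i=1..j. fps_nth ?L i * fps_nth ?f (j - i))"
    by (simp add: fps_mult_nth sum.atLeast_Suc_atMost L0)
  finally have "of_nat j * sigma_mean R f j
      = (\<Sum>i=1..j. fps_nth ?L i * fps_nth ?f (j - i) / of_nat (order R) ^ j)"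
    by (simp add: \<sigma> sum_divide_distrib)
  also have "\<dots> = (\<Sum>i=1..j. chi_mean R \<Lambda> i * sigma_mean R f (j - i))"
    using q by (intro sum.cong refl) (simp add: \<sigma> chi power_add[symmetric])
  finally show ?thesis .
qed

section \<open>Size of the maximum, and approximation of n \<sigma>(n) by the window sum\<close>

context
  fixes R :: "('a, 'b) ring_scheme" and \<Lambda> :: "'a list \<Rightarrow> complex" and \<kappa> :: real and n :: nat
  assumes chi: "\<And>j. 1 \<le> j \<Longrightarrow> norm (chi_mean R \<Lambda> j) \<le> \<kappa>" and n: "1 \<le> n"
    and field: "field R" and fin: "finite (carrier R)"
begin

text \<open>With |qz| = 1 the exponent is dominated termwise by a harmonic sum. The bound serves
  twice: it makes the supremum finite, and it limits how negative M can be.\<close>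

lemma norm_F_perp_le:
  assumes "norm z = 1 / real (order R)"
  shows "norm (F_perp R \<Lambda> n z) \<le> exp (\<kappa> * (ln (real n) + 1))"
proof -
  interpret field R by fact
  have q: "order R \<noteq> 0"
    using fin order_gt_0_iff_finite by simp
  have "0 \<le> \<kappa>"
    using chi[of 1] order_trans[OF norm_ge_zero] by blast
  have "norm (of_nat (order R) * z) = 1"
    using assms q by (simp add: norm_mult)
  then have [simp]: "norm ((of_nat (order R) * z) ^ j) = 1" for j
    by (simp add: norm_power)
  let ?S = "\<Sum>j = 1..<n. chi_mean R \<Lambda> j / of_nat j * (of_nat (order R) * z) ^ j"
  have "norm ?S \<le> (\<Sum>j = 1..<n. \<kappa> * inverse (real j))"
  proof (rule sum_norm_le)
    fix j
    assume "j \<in> {1..<n}"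
    then show "norm (chi_mean R \<Lambda> j / of_nat j * (of_nat (order R) * z) ^ j) \<le> \<kappa> * inverse (real j)"
      using chi[of j] unfolding norm_mult[of "chi_mean R \<Lambda> j / of_nat j"] norm_divide
        by (simp add: divide_simps del: power_mult_distrib)
  qed
  also have "\<dots> \<le> (\<Sum>j = 1..n. \<kappa> * inverse (real j))"
    using \<open>0 \<le> \<kappa>\<close> by (intro sum_mono2) auto
  also have "\<dots> = \<kappa> * harm n"
    by (simp add: harm_def sum_distrib_left)
  \<comment> \<open>\<open>harm n - ln n\<close> is decreasing and equals 1 at n = 1.\<close>
  also have "\<dots> \<le> \<kappa> * (ln (real n) + 1)"
    using \<open>0 \<le> \<kappa>\<close> euler_mascheroni_sequence_decreasing[of 1 n] n
    by (intro mult_left_mono) (auto simp: harm_expand)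
  finally show ?thesis
    unfolding F_perp_def by (intro order_trans[OF norm_exp]) simp
qed

lemma norm_exp_le_max_F_perp:
  assumes "norm z = 1"
  shows "norm (exp (\<Sum>j=1..<n. chi_mean R \<Lambda> j / of_nat j * z ^ j)) \<le> max_F_perp R \<Lambda> n"
proof -
  interpret field R by fact
  have q: "order R \<noteq> 0"
    using fin order_gt_0_iff_finite by simp
  have "norm (F_perp R \<Lambda> n (z / of_nat (order R))) \<le> max_F_perp R \<Lambda> n"
    unfolding max_F_perp_def using assms norm_F_perp_le
    by (intro cSUP_upper bdd_aboveI2) (auto simp: norm_divide)
  then show ?thesis
    using q by (simp add: F_perp_def)
qed

lemma max_F_perp_le: "max_F_perp R \<Lambda> n \<le> exp (\<kappa> * (ln (real n) + 1))"
  unfolding max_F_perp_def using norm_F_perp_le by (intro cSUP_least) auto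

text \<open>The condition \<kappa> + 1 = o(M) controls only |M|; this bound is what later excludes
  large negative M. It comes from taking logarithms in \<open>max_F_perp_le\<close>.\<close>

lemma neg_le_of_max_F_perp:
  assumes "exp (- M) * (2 * real n) powr \<kappa> = max_F_perp R \<Lambda> n"
  shows "- \<kappa> \<le> M"
proof -
  have "0 \<le> \<kappa>"
    using chi[of 1] order_trans[OF norm_ge_zero] by blast
  then have "\<kappa> * ln (real n) \<le> \<kappa> * ln (2 * real n)"
    using n by (intro mult_left_mono) auto
  moreover have "exp (- M + \<kappa> * ln (2 * real n)) \<le> exp (\<kappa> * (ln (real n) + 1))"
    using assms max_F_perp_le n by (simp add: exp_add[symmetric] powr_def del: exp_le_cancel_iff)
  ultimately show ?thesis
    by (simp add: algebra_simps)
qed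

text \<open>The terms of the recursion outside the window satisfy n - j \<ge> \<delta> n, so
  \<open>convolution_bound\<close> applies to them.\<close>

lemma sigma_mean_approx:
  assumes "f \<one>\<^bsub>poly_ring R\<^esub> = 1" and "is_von_mangoldt R f \<Lambda>" and "0 < \<delta>" and "\<delta> < 1"
  shows "norm (of_nat n * sigma_mean R f n
      - (\<Sum>j | (1 - \<delta>) * (real n - 1) < real j \<and> j \<le> n. chi_mean R \<Lambda> j * sigma_mean R f (n - j)))
    \<le> \<kappa>\<^sup>2 * max_F_perp R \<Lambda> n / \<delta>"
proof -
  let ?c = "\<lambda>j. chi_mean R \<Lambda> j * sigma_mean R f (n - j)"
  let ?T = "{j. (1 - \<delta>) * (real n - 1) < real j \<and> j \<le> n}"
  define J where "J = {j. 1 \<le> j \<and> real j \<le> (1 - \<delta>) * (real n - 1)}"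
  have far: "\<delta> * real n \<le> real n - real j \<and> j < n" if "j \<in> J" for j
  proof -
    have "real j \<le> (1 - \<delta>) * (real n - 1)"
      using that by (simp add: J_def)
    \<comment> \<open>Passing from n - 1 to n leaves the term 1 - \<delta>, which has the favourable
      sign.\<close>
    also have "\<dots> = real n - \<delta> * real n - (1 - \<delta>)"
      by (simp add: algebra_simps)
    finally have "\<delta> * real n \<le> real n - real j"
      using \<open>\<delta> < 1\<close> by simp
    moreover have "0 < \<delta> * real n"
      using \<open>0 < \<delta>\<close> n by simp
    ultimately show ?thesis by linarith
  qed
  \<comment> \<open>The lower end of the window is nonnegative and the inequality strict, so j = 0
    is excluded, as in the recursion.\<close>
  have pos: "1 \<le> j" if "j \<in> ?T" for j
  proof -
    have "0 \<le> (1 - \<delta>) * (real n - 1)"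
      using \<open>\<delta> < 1\<close> n by simp
    with that have "0 < real j"
      by simp
    then show ?thesis by simp
  qed
  have J: "J \<subseteq> {1..<n}"
    using far by (auto simp: J_def)
  have T: "{1..n} = ?T \<union> J" "?T \<inter> J = {}"
    using pos far by (auto simp: J_def) force+
  have "of_nat n * sigma_mean R f n = sum ?c {1..n}"
    using sigma_mean_recursion[OF field fin assms(1,2), of n] .
  also have "\<dots> = sum ?c ?T + sum ?c J"
    unfolding T(1) using T(2) J finite_subset by (intro sum.union_disjoint) auto
  finally have "norm (of_nat n * sigma_mean R f n - sum ?c ?T) = norm (sum ?c J)"
    by simp
  also have "\<dots> \<le> \<kappa>\<^sup>2 * max_F_perp R \<Lambda> n / \<delta>"
    using sigma_mean_zero[of R f] sigma_mean_recursion[of R f \<Lambda>] field fin assms far n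
    by (intro convolution_bound[where n = n] chi norm_exp_le_max_F_perp J) auto
  finally show ?thesis .
qed

end

section \<open>Comparison of orders of magnitude\<close>

theorem theorem1p4:
  fixes R :: "nat \<Rightarrow> ('a, 'b) ring_scheme"
    and \<kappa> M :: "nat \<Rightarrow> real"
    and n :: "nat \<Rightarrow> nat"
    and f \<Lambda> :: "nat \<Rightarrow> 'a list \<Rightarrow> complex"
  assumes "\<And>k. field (R k)" and "\<And>k. finite (carrier (R k))"
    and "\<And>k. 0 < \<kappa> k"
    and "\<And>k. 1 \<le> n k" and "filterlim n at_top sequentially"
    and "\<And>k. multiplicative_on_monics (R k) (f k)"
    and "\<And>k. f k \<one>\<^bsub>poly_ring (R k)\<^esub> = 1"
    and "\<And>k. converges_absolutely (R k) (f k)"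
    and "\<And>k. is_von_mangoldt (R k) (f k) (\<Lambda> k)"
    and "\<And>k j. 1 \<le> j \<Longrightarrow> norm (chi_mean (R k) (\<Lambda> k) j) \<le> \<kappa> k"
    and "\<And>k. exp (- M k) * (2 * real (n k)) powr \<kappa> k = max_F_perp (R k) (\<Lambda> k) (n k)"
    and "(\<lambda>k. \<kappa> k + 1) \<in> o(M)"
  shows
    "(\<lambda>k. norm (sigma_mean (R k) (f k) (n k)))
        \<in> \<Omega>(\<lambda>k. \<kappa> k * (\<kappa> k + 1 + M k) * exp (- M k) * (2 * real (n k)) powr (\<kappa> k - 1))
     \<longleftrightarrow>
     (\<forall>\<delta>. admissible_delta \<delta> \<longrightarrow>
        (\<lambda>k. norm (\<Sum>j | (1 - \<delta> k) * (real (n k) - 1) < real j \<and> j \<le> n k.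
                      chi_mean (R k) (\<Lambda> k) j * sigma_mean (R k) (f k) (n k - j)))
          \<in> \<Omega>(\<lambda>k. \<kappa> k * M k * exp (- M k) * (2 * real (n k)) powr \<kappa> k))"
    (is "?lhs \<longleftrightarrow> (\<forall>\<delta>. _ \<longrightarrow> ?rhs \<delta>)")
proof -
  define K where "K k = exp (- M k) * (2 * real (n k)) powr \<kappa> k" for k
  define s where "s k = real (n k) * norm (sigma_mean (R k) (f k) (n k))" for k
  define S where "S \<delta> k = norm (\<Sum>j | (1 - \<delta> k) * (real (n k) - 1) < real j \<and> j \<le> n k.
    chi_mean (R k) (\<Lambda> k) j * sigma_mean (R k) (f k) (n k - j))" for \<delta> k
  note \<kappa> = assms(3) and n = assms(4)
  have K: "0 < K k" for k
    using n[of k] by (simp add: K_def)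
  have s: "s k = norm (of_nat (n k) * sigma_mean (R k) (f k) (n k))" for k
    by (simp add: s_def norm_mult)
  \<comment> \<open>Relative to \<open>\<kappa> k * K k\<close> the error is \<kappa>/\<delta>, to
    be compared with M.\<close>
  have approx: "\<bar>s k - S \<delta> k\<bar> \<le> \<kappa> k * K k * (\<kappa> k / \<delta> k)" if "0 < \<delta> k" "\<delta> k < 1" for \<delta> k
  proof -
    have "\<bar>s k - S \<delta> k\<bar> \<le> norm (of_nat (n k) * sigma_mean (R k) (f k) (n k)
        - (\<Sum>j | (1 - \<delta> k) * (real (n k) - 1) < real j \<and> j \<le> n k.
            chi_mean (R k) (\<Lambda> k) j * sigma_mean (R k) (f k) (n k - j)))"
      unfolding s S_def by (rule norm_triangle_ineq3)
    also have "\<dots> \<le> (\<kappa> k)\<^sup>2 * max_F_perp (R k) (\<Lambda> k) (n k) / \<delta> k"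
      using assms that by (intro sigma_mean_approx)
    finally show ?thesis
      unfolding K_def assms(11) by (simp add: power2_eq_square mult_ac)
  qed
  have small: "eventually (\<lambda>k. 0 < M k \<and> \<kappa> k + 1 \<le> \<epsilon> * M k) at_top" if "0 < \<epsilon>" for \<epsilon> :: real
  proof -
    \<comment> \<open>The minimum with 1 forces |M| \<ge> \<kappa> + 1, which together with M \<ge>
      -\<kappa> makes M positive.\<close>
    have "eventually (\<lambda>k. norm (\<kappa> k + 1) \<le> min \<epsilon> 1 * norm (M k)) at_top"
      using assms(12) \<open>0 < \<epsilon>\<close> by (intro landau_o.smallD) auto
    then show ?thesis
    proof eventually_elim
      case (elim k)
      have "- \<kappa> k \<le> M k"
        using assms by (intro neg_le_of_max_F_perp)
      moreover have "min \<epsilon> 1 * \<bar>M k\<bar> \<le> 1 * \<bar>M k\<bar>"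
        by (intro mult_right_mono) auto
      ultimately have "0 < M k"
        using elim \<kappa>[of k] by (simp add: abs_if split: if_splits)
      moreover have "min \<epsilon> 1 * M k \<le> \<epsilon> * M k"
        using \<open>0 < M k\<close> by (intro mult_right_mono) auto
      moreover have "\<kappa> k + 1 \<le> min \<epsilon> 1 * M k"
        using elim \<kappa>[of k] \<open>0 < M k\<close> by simp
      ultimately show ?case
        by linarith
    qed
  qed
  have lhs: "\<kappa> k * (\<kappa> k + 1 + M k) * exp (- M k) * (2 * real (n k)) powr (\<kappa> k - 1)
      = \<kappa> k * K k * (\<kappa> k + 1 + M k) / (2 * real (n k))" for k
    using n[of k] by (simp add: K_def powr_diff)
  have rhs: "\<kappa> k * M k * exp (- M k) * (2 * real (n k)) powr \<kappa> k = \<kappa> k * K k * M k" for k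
    by (simp add: K_def)
  show ?thesis
  proof (intro iffI allI impI)
    fix \<delta>
    assume ?lhs and "admissible_delta \<delta>"
    then obtain d where "0 < d" and \<delta>: "\<And>k. 0 < \<delta> k" "\<And>k. \<delta> k < 1" "\<And>k. d \<le> \<delta> k"
      by (auto simp: admissible_delta_def)
    obtain c where "0 < c" and c: "eventually (\<lambda>k. c * norm (\<kappa> k * K k * (\<kappa> k + 1 + M k) / (2 * real (n k)))
        \<le> norm (norm (sigma_mean (R k) (f k) (n k)))) at_top"
      using \<open>?lhs\<close> unfolding lhs by (elim landau_omega.bigE)
    \<comment> \<open>Multiplying the lower bound by n turns c/(2n) into c/2. With \<delta> \<ge> d
      this choice keeps the error below a c/4 share, so c/4 survives.\<close>
    have "0 < c * d / 4"
      using \<open>0 < c\<close> \<open>0 < d\<close> by simp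
    have "eventually (\<lambda>k. c / 4 * norm (\<kappa> k * K k * M k) \<le> norm (S \<delta> k)) at_top"
      using c small[OF \<open>0 < c * d / 4\<close>]
    proof eventually_elim
      case (elim k)
      have M: "0 < M k" "\<kappa> k \<le> c * d / 4 * M k"
        using elim \<open>0 < c\<close> \<open>0 < d\<close> by auto
      have pos: "0 < \<kappa> k * K k" "0 < real (n k)"
        using \<kappa>[of k] K[of k] n[of k] by auto
      have "c * (\<kappa> k * K k * (\<kappa> k + 1 + M k) / (2 * real (n k)))
          \<le> norm (sigma_mean (R k) (f k) (n k))"
        using elim pos M \<kappa>[of k] K[of k] by (simp add: abs_mult)
      then have 1: "c / 2 * (\<kappa> k * K k * (\<kappa> k + 1 + M k)) \<le> s k"
        using pos by (simp add: s_def field_simps)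
      have 2: "c / 2 * (\<kappa> k * K k * M k) \<le> c / 2 * (\<kappa> k * K k * (\<kappa> k + 1 + M k))"
        using pos \<open>0 < c\<close> \<kappa>[of k] by (intro mult_left_mono) auto
      have "\<kappa> k / \<delta> k \<le> (c * d / 4 * M k) / d"
        using M \<open>0 < d\<close> \<delta>[of k] \<kappa>[of k] by (intro frac_le) auto
      then have "\<kappa> k * K k * (\<kappa> k / \<delta> k) \<le> \<kappa> k * K k * (c / 4 * M k)"
        using pos \<open>0 < d\<close> by (intro mult_left_mono) auto
      then have "\<kappa> k * K k * (\<kappa> k / \<delta> k) \<le> c / 4 * (\<kappa> k * K k * M k)"
        by (simp only: mult_ac)
      moreover have "s k - S \<delta> k \<le> \<kappa> k * K k * (\<kappa> k / \<delta> k)"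
        using approx[of \<delta> k] \<delta> abs_le_D1 by blast
      ultimately have "c / 4 * (\<kappa> k * K k * M k) \<le> S \<delta> k"
        using 1 2 by linarith
      then show ?case
        using M \<kappa>[of k] K[of k] by (simp add: abs_mult S_def)
    qed
    then show "?rhs \<delta>"
      unfolding rhs S_def using \<open>0 < c\<close> by (intro landau_omega.bigI[of "c / 4"]) auto
  next
    assume "\<forall>\<delta>. admissible_delta \<delta> \<longrightarrow> ?rhs \<delta>"
    \<comment> \<open>A single constant \<delta> suffices here, since its window sum already
      determines n \<sigma>(n) up to a negligible error.\<close>
    moreover have "admissible_delta (\<lambda>k. 1/2)"
      unfolding admissible_delta_def by (auto intro: exI[of _ "1/2"])
    ultimately have "?rhs (\<lambda>k. 1/2)"
      by blast
    then obtain c where "0 < c"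
      and c: "eventually (\<lambda>k. c * norm (\<kappa> k * K k * M k) \<le> norm (S (\<lambda>k. 1/2) k)) at_top"
      unfolding rhs S_def by (elim landau_omega.bigE)
    have "0 < c / 4"
      using \<open>0 < c\<close> by simp
    \<comment> \<open>The error 2\<kappa> is at most (c/2) M, leaving (c/2) M, and \<kappa> + 1
      \<le> M turns this into (c/4)(\<kappa> + 1 + M). Dividing by n against the denominator 2n
      doubles c/4 to c/2.\<close>
    have "eventually (\<lambda>k. c / 2 * norm (\<kappa> k * K k * (\<kappa> k + 1 + M k) / (2 * real (n k)))
        \<le> norm (norm (sigma_mean (R k) (f k) (n k)))) at_top"
      using c small[OF \<open>0 < c / 4\<close>] small[OF zero_less_one]
    proof eventually_elim
      case (elim k)
      have pos: "0 < \<kappa> k * K k" "0 < real (n k)"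
        using \<kappa>[of k] K[of k] n[of k] by auto
      have 1: "c * (\<kappa> k * K k * M k) \<le> S (\<lambda>k. 1/2) k"
        using elim \<kappa>[of k] K[of k] by (simp add: abs_mult S_def)
      have 2: "\<kappa> k * K k * (\<kappa> k / (1/2)) \<le> \<kappa> k * K k * (c / 2 * M k)"
        using elim pos by (intro mult_left_mono) auto
      have 3: "c / 4 * (\<kappa> k * K k * (\<kappa> k + 1 + M k)) \<le> c / 4 * (\<kappa> k * K k * (2 * M k))"
        using elim pos \<open>0 < c\<close> by (intro mult_left_mono) auto
      have "c / 4 * (\<kappa> k * K k * (\<kappa> k + 1 + M k)) \<le> s k"
        using 1 2 3 approx[of "\<lambda>k. 1/2" k] by (simp add: abs_le_iff algebra_simps)
      then have "c / 2 * (\<kappa> k * K k * (\<kappa> k + 1 + M k) / (2 * real (n k)))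
          \<le> norm (sigma_mean (R k) (f k) (n k))"
        using pos by (simp add: s_def field_simps)
      then show ?case
        using pos elim \<kappa>[of k] K[of k] by (simp add: abs_mult)
    qed
    then show ?lhs
      unfolding lhs using \<open>0 < c\<close> by (intro landau_omega.bigI[of "c / 2"]) auto
  qed
qed

end
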